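(* Let $I(\boldsymbol{B},\boldsymbol{r})$ be an anti-diagonal (resp. diagonal) blockwise determinantal ideal with $\boldsymbol{B}=(B_1,\dots,B_k)$, $\boldsymbol{r}=(r_1,\dots,r_k)$, and fix an anti-diagonal (resp. diagonal) term order. Let $\boldsymbol{t}$ be a term of some minor generator from a block $B=B_i$ (i.e. a term of an $r_i$-minor in $B_i$). Then for each other block $\tilde B=B_j$ ($j\neq i$), with $\tilde r=r_j$ the size of the minors in $\tilde B$, there exists an $\tilde r$-minor $\boldsymbol{m}$ in $\tilde B$ such that $\mathrm{lt}(\boldsymbol{m})\mid \boldsymbol{t}$ if and only if $l_a(\boldsymbol{t},\tilde B)\ge \tilde r$ (resp. $l_d(\boldsymbol{t},\tilde B)\ge\tilde r$).
   Context: Let $K$ be a field and $X=(x_{ij})$ a generic $m\times n$ matrix ($m\le n$) of distinct variables; $K[\boldsymbol{x}]$ is the polynomial ring in all $mn$ variables. A subset of $X$ means a set of entries. An $r$-minor of $X$ is the determinant of an $r\times r$ submatrix (given by arbitrary row and column index sets of size $r$), regarded as a polynomial; it is a minor in a subset $B$ if all entries of the submatrix belong to $B$. A term is a monomial; a term of a polynomial is a monomial appearing with nonzero coefficient; $\mathrm{lt}$ denotes the leading term. A term order is anti-diagonal (resp. diagonal) if the leading term of every minor of $X$ is the product of the anti-diagonal (resp. diagonal) entries of the corresponding submatrix. A non-empty subset $B$ of $X$ is anti-diagonal if whenever $x_{pq},x_{\tilde p\tilde q}\in B$ with $p\ge\tilde p$, $q\le\tilde q$, all $x_{ij}$ with $\tilde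 p\le i\le p$, $q\le j\le\tilde q$ belong to $B$. It is diagonal if whenever $x_{pq},x_{\tilde p\tilde q}\in B$ with $p\le\tilde p$, $q\le\tilde q$, all $x_{ij}$ with $p\le i\le\tilde p$, $q\le j\le\tilde q$ belong to $B$. For a sequence $\boldsymbol{B}=(B_1,\dots,B_k)$ of non-empty subsets of $X$ (blocks) and a sequence $\boldsymbol{r}=(r_1,\dots,r_k)$ of positive integers, the blockwise determinantal ideal $I(\boldsymbol{B},\boldsymbol{r})\subseteq K[\boldsymbol{x}]$ is generated by all $r_i$-minors in $B_i$ for all $i$; it is called anti-diagonal (resp. diagonal) when all its blocks are. A term $\boldsymbol{t}$ of a minor is a product $\prod_{k=1}^r x_{i_kj_k}$ of entries from distinct rows and columns, written with $i_1<\cdots<i_r$. For a subset $B$ of $X$, keep only those pairs $(i_k,j_k)$ with $x_{i_kj_k}\in B$, in increasing order of $i_k$, and let $s(\boldsymbol{t}\cap B)$ be the resulting sequence of the column indices $j_k$. The anti-diagonal length $l_a(\boldsymbol{t},B)$ (resp. diagonal length $l_d(\boldsymbol{t},B)$) is the length of the longest decreasing (resp. increasing) subsequence of $s(\boldsymbol{t}\cap B)$. *)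

theory Defs
  imports
    "HOL-Library.Poly_Mapping"
    "HOL-Library.Sublist"
    "Jordan_Normal_Form.Determinant"
    "Jordan_Normal_Form.DL_Submatrix"
begin

text \<open>
  Rows and columns are numbered from 0, so the entries of the generic \<open>m \<times> n\<close> matrix are the
  variables indexed by \<open>(i, j)\<close> with \<open>i < m\<close> and \<open>j < n\<close>. Monomials are written additively as
  exponent vectors, and polynomials are finitely supported functions on monomials; the terms of
  a polynomial \<open>f\<close> are thus the elements of \<open>keys f\<close>.
\<close>

type_synonym monomial = "nat \<times> nat \<Rightarrow>\<^sub>0 nat"
type_synonym 'k polynomial = "monomial \<Rightarrow>\<^sub>0 'k"

definition entries :: "nat \<Rightarrow> nat \<Rightarrow> (nat \<times> nat) set" where
  "entries m n = {..<m} \<times> {..<n}"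

definition monomials :: "nat \<Rightarrow> nat \<Rightarrow> monomial set" where
  "monomials m n = {t. Poly_Mapping.keys t \<subseteq> entries m n}"

definition polynomials :: "nat \<Rightarrow> nat \<Rightarrow> 'k::field polynomial set" where
  "polynomials m n = {f. Poly_Mapping.keys f \<subseteq> monomials m n}"

definition mono_var :: "nat \<Rightarrow> nat \<Rightarrow> monomial" where
  "mono_var i j = Poly_Mapping.single (i, j) 1"

text \<open>Divisibility of monomials; the product of monomials is the sum of exponent vectors.\<close>

definition mono_dvd :: "monomial \<Rightarrow> monomial \<Rightarrow> bool" where
  "mono_dvd s t \<longleftrightarrow> (\<exists>u. t = s + u)"

definition generic_mat :: "nat \<Rightarrow> nat \<Rightarrow> 'k::field polynomial mat" where
  "generic_mat m n = mat m n (\<lambda>(i, j). Poly_Mapping.single (mono_var i j) 1)"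

definition minor :: "nat \<Rightarrow> nat \<Rightarrow> nat set \<Rightarrow> nat set \<Rightarrow> 'k::field polynomial" where
  "minor m n P Q = det (submatrix (generic_mat m n) P Q)"

text \<open>The row and column sets of the \<open>r \<times> r\<close> submatrices all of whose entries belong to \<open>B\<close>.\<close>

definition minor_indices :: "nat \<Rightarrow> nat \<Rightarrow> (nat \<times> nat) set \<Rightarrow> nat \<Rightarrow> (nat set \<times> nat set) set" where
  "minor_indices m n B r =
     {(P, Q). P \<subseteq> {..<m} \<and> Q \<subseteq> {..<n} \<and> card P = r \<and> card Q = r \<and> P \<times> Q \<subseteq> B}"

definition minors_in :: "nat \<Rightarrow> nat \<Rightarrow> (nat \<times> nat) set \<Rightarrow> nat \<Rightarrow> 'k::field polynomial set" where
  "minors_in m n B r = (\<lambda>(P, Q). minor m n P Q) ` minor_indices m n B r"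

text \<open>
  Term orders on the monomials in the entries of the matrix. A pair \<open>(s, t) \<in> R\<close> means
  \<open>s \<le> t\<close>, and \<open>0\<close> is the monomial 1. Well-foundedness follows by Dickson's lemma.
\<close>

definition term_order :: "nat \<Rightarrow> nat \<Rightarrow> monomial rel \<Rightarrow> bool" where
  "term_order m n R \<longleftrightarrow>
     linear_order_on (monomials m n) R \<and>
     (\<forall>t\<in>monomials m n. (0, t) \<in> R) \<and>
     (\<forall>s t. \<forall>u\<in>monomials m n. (s, t) \<in> R \<longrightarrow> (s + u, t + u) \<in> R)"

definition lt :: "monomial rel \<Rightarrow> 'k::field polynomial \<Rightarrow> monomial" where
  "lt R f = (THE t. t \<in> Poly_Mapping.keys f \<and> (\<forall>s\<in>Poly_Mapping.keys f. (s, t) \<in> R))"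

text \<open>Here \<open>pick P k\<close> is the \<open>k\<close>-th smallest element of \<open>P\<close>, counted from 0.\<close>

definition antidiagonal_product :: "nat set \<Rightarrow> nat set \<Rightarrow> monomial" where
  "antidiagonal_product P Q = (\<Sum>k<card P. mono_var (pick P k) (pick Q (card Q - 1 - k)))"

definition diagonal_product :: "nat set \<Rightarrow> nat set \<Rightarrow> monomial" where
  "diagonal_product P Q = (\<Sum>k<card P. mono_var (pick P k) (pick Q k))"

text \<open>The type argument provides the coefficient field.\<close>

definition antidiagonal_term_order :: "'k::field itself \<Rightarrow> nat \<Rightarrow> nat \<Rightarrow> monomial rel \<Rightarrow> bool" where
  "antidiagonal_term_order _ m n R \<longleftrightarrow>
     term_order m n R \<and>
     (\<forall>r>0. \<forall>(P, Q)\<in>minor_indices m n (entries m n) r.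
        lt R (minor m n P Q :: 'k polynomial) = antidiagonal_product P Q)"

definition diagonal_term_order :: "'k::field itself \<Rightarrow> nat \<Rightarrow> nat \<Rightarrow> monomial rel \<Rightarrow> bool" where
  "diagonal_term_order _ m n R \<longleftrightarrow>
     term_order m n R \<and>
     (\<forall>r>0. \<forall>(P, Q)\<in>minor_indices m n (entries m n) r.
        lt R (minor m n P Q :: 'k polynomial) = diagonal_product P Q)"

definition antidiagonal_block :: "(nat \<times> nat) set \<Rightarrow> bool" where
  "antidiagonal_block B \<longleftrightarrow>
     B \<noteq> {} \<and>
     (\<forall>p q p' q'. (p, q) \<in> B \<and> (p', q') \<in> B \<and> p' \<le> p \<and> q \<le> q' \<longrightarrow> {p'..p} \<times> {q..q'} \<subseteq> B)"

definition diagonal_block :: "(nat \<times> nat) set \<Rightarrow> bool" where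
  "diagonal_block B \<longleftrightarrow>
     B \<noteq> {} \<and>
     (\<forall>p q p' q'. (p, q) \<in> B \<and> (p', q') \<in> B \<and> p \<le> p' \<and> q \<le> q' \<longrightarrow> {p..p'} \<times> {q..q'} \<subseteq> B)"

definition block_data :: "nat \<Rightarrow> nat \<Rightarrow> (nat \<times> nat) set list \<Rightarrow> nat list \<Rightarrow> bool" where
  "block_data m n Bs rs \<longleftrightarrow>
     length Bs = length rs \<and>
     (\<forall>B\<in>set Bs. B \<noteq> {} \<and> B \<subseteq> entries m n) \<and>
     (\<forall>r\<in>set rs. 0 < r)"

definition minor_generators ::
  "nat \<Rightarrow> nat \<Rightarrow> (nat \<times> nat) set list \<Rightarrow> nat list \<Rightarrow> 'k::field polynomial set" where
  "minor_generators m n Bs rs = (\<Union>i<length Bs. minors_in m n (Bs ! i) (rs ! i))"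

lemma finite_minor_generators: "finite (minor_generators m n Bs rs)"
proof -
  have "minor_indices m n B r \<subseteq> Pow {..<m} \<times> Pow {..<n}" for B r
    by (auto simp: minor_indices_def)
  then have "finite (minor_indices m n B r)" for B r
    by (rule finite_subset) simp
  then show ?thesis
    by (auto simp: minor_generators_def minors_in_def)
qed

text \<open>
  The ideal generated by the minors in the polynomial ring in the entries. The generating set
  is finite, so the sum below is a genuine one.
\<close>

definition blockwise_ideal ::
  "nat \<Rightarrow> nat \<Rightarrow> (nat \<times> nat) set list \<Rightarrow> nat list \<Rightarrow> 'k::field polynomial set" where
  "blockwise_ideal m n Bs rs =
     {\<Sum>g\<in>minor_generators m n Bs rs. c g * g | c.
        \<forall>g\<in>minor_generators m n Bs rs. c g \<in> polynomials m n}"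

definition antidiagonal_blockwise_ideal ::
  "nat \<Rightarrow> nat \<Rightarrow> (nat \<times> nat) set list \<Rightarrow> nat list \<Rightarrow> 'k::field polynomial set \<Rightarrow> bool" where
  "antidiagonal_blockwise_ideal m n Bs rs I \<longleftrightarrow>
     block_data m n Bs rs \<and> (\<forall>B\<in>set Bs. antidiagonal_block B) \<and> I = blockwise_ideal m n Bs rs"

definition diagonal_blockwise_ideal ::
  "nat \<Rightarrow> nat \<Rightarrow> (nat \<times> nat) set list \<Rightarrow> nat list \<Rightarrow> 'k::field polynomial set \<Rightarrow> bool" where
  "diagonal_blockwise_ideal m n Bs rs I \<longleftrightarrow>
     block_data m n Bs rs \<and> (\<forall>B\<in>set Bs. diagonal_block B) \<and> I = blockwise_ideal m n Bs rs"

text \<open>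
  The sequence \<open>s(t \<inter> B)\<close>. For a term \<open>t\<close> of a minor the variables in \<open>keys t\<close> lie in distinct
  rows, so sorting them by row is unambiguous.
\<close>

definition col_seq :: "monomial \<Rightarrow> (nat \<times> nat) set \<Rightarrow> nat list" where
  "col_seq t B = map snd (sorted_key_list_of_set fst (Poly_Mapping.keys t \<inter> B))"

definition antidiagonal_length :: "monomial \<Rightarrow> (nat \<times> nat) set \<Rightarrow> nat" where
  "antidiagonal_length t B = Max {length ys | ys. subseq ys (col_seq t B) \<and> sorted_wrt (>) ys}"

definition diagonal_length :: "monomial \<Rightarrow> (nat \<times> nat) set \<Rightarrow> nat" where
  "diagonal_length t B = Max {length ys | ys. subseq ys (col_seq t B) \<and> sorted_wrt (<) ys}"

end

theory Submission
  imports Defs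
begin

text \<open>
  Every monomial in the theorem is a product of distinct variables, at most one from each row:
  expanding a minor over permutations shows this for its terms, and a product along a diagonal or
  antidiagonal visibly has this shape. Divisibility of such monomials is inclusion of their sets
  of variables, so everything reduces to comparing finite sets of positions.

  Call a list of positions a chain if its rows strictly increase and its columns strictly decrease
  in the antidiagonal case, and strictly increase in the diagonal case. Both sides of the equivalence say
  that the positions of \<open>t\<close> in the block \<open>B\<close> contain a chain of length \<open>r\<close>.

  On the side of lengths, a monotone subsequence of the column sequence of \<open>t \<inter> B\<close> is the column
  list of a chain, because sorting by rows is unambiguous (\<open>subseq_sorted_key_list_iff_chain\<close>).
  On the side of minors, the factors of the leading term of an \<open>r\<close>-minor form a chain of length
  \<open>r\<close>. Conversely, the rows and the columns of a chain in \<open>B\<close> span a submatrix that has this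
  chain as its antidiagonal or diagonal. The shape of the block enters exactly here: any two
  elements of the chain are opposite corners of a rectangle contained in \<open>B\<close>, so all entries of
  the spanned submatrix lie in \<open>B\<close> (\<open>antidiagonal_block_chain\<close>, \<open>diagonal_block_chain\<close>).

  The two cases differ only in the order \<open>ord\<close> on columns and in the formula \<open>lead\<close> for leading
  terms; \<open>minor_dvd_iff_chain\<close> and \<open>initial_term_dvd_iff_length\<close> abstract over both.
\<close>

section \<open>Squarefree monomials\<close>

definition squarefree_monomial :: "(nat \<times> nat) set \<Rightarrow> monomial" where
  "squarefree_monomial S = (\<Sum>x\<in>S. Poly_Mapping.single x 1)"

lemma lookup_squarefree_monomial:
  assumes "finite S"
  shows "Poly_Mapping.lookup (squarefree_monomial S) x = (if x \<in> S then 1 else 0)"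
  using assms by (simp add: squarefree_monomial_def lookup_sum lookup_single when_def)

lemma keys_squarefree_monomial:
  assumes "finite S"
  shows "Poly_Mapping.keys (squarefree_monomial S) = S"
  using assms by (auto simp: in_keys_iff lookup_squarefree_monomial split: if_splits)

lemma squarefree_monomial_dvd_iff:
  assumes "finite S" "finite T"
  shows "mono_dvd (squarefree_monomial S) (squarefree_monomial T) \<longleftrightarrow> S \<subseteq> T"
proof
  assume "mono_dvd (squarefree_monomial S) (squarefree_monomial T)"
  then obtain u where u: "squarefree_monomial T = squarefree_monomial S + u"
    by (auto simp: mono_dvd_def)
  show "S \<subseteq> T"
  proof
    fix x assume "x \<in> S"
    then have "Poly_Mapping.lookup (squarefree_monomial T) x > 0"
      using assms by (simp add: u lookup_add lookup_squarefree_monomial)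
    then show "x \<in> T"
      using assms by (simp add: lookup_squarefree_monomial split: if_splits)
  qed
next
  assume "S \<subseteq> T"
  then have "squarefree_monomial T = squarefree_monomial S + squarefree_monomial (T - S)"
    using assms by (simp add: squarefree_monomial_def sum.subset_diff add.commute)
  then show "mono_dvd (squarefree_monomial S) (squarefree_monomial T)"
    by (auto simp: mono_dvd_def)
qed

lemma sum_nth_eq_squarefree_monomial:
  assumes "distinct ps"
  shows "(\<Sum>k<length ps. Poly_Mapping.single (ps ! k) 1) = squarefree_monomial (set ps)"
  unfolding squarefree_monomial_def
  using sum.reindex_bij_betw[OF bij_betw_nth[OF assms refl refl], of "\<lambda>x. Poly_Mapping.single x 1"] .

lemma prod_single:
  "finite A \<Longrightarrow> (\<Prod>i\<in>A. Poly_Mapping.single (g i) (1::'b::comm_semiring_1)) =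
     Poly_Mapping.single (\<Sum>i\<in>A. g i) 1"
  by (induction A rule: finite_induct) (simp_all add: mult_single)

section \<open>Terms of minors\<close>

lemma pick_eq_nth_sorted_list_of_set:
  assumes "finite S" "k < card S"
  shows "pick S k = sorted_list_of_set S ! k"
proof -
  let ?xs = "map (pick S) [0..<card S]"
  have sorted: "sorted_wrt (<) ?xs"
    by (auto simp: sorted_wrt_iff_nth_less intro: pick_mono_le)
  have "set ?xs \<subseteq> S"
    by (auto intro: pick_in_set_le)
  moreover have "card (set ?xs) = card S"
    using distinct_card[of ?xs] sorted by (simp add: strict_sorted_iff)
  ultimately have "set ?xs = S"
    using assms(1) by (metis card_subset_eq)
  then have "?xs = sorted_list_of_set S"
    using sorted assms(1)
    by (intro strict_sorted_equal) (simp_all add: strict_sorted_iff)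
  then have "sorted_list_of_set S ! k = ?xs ! k"
    by simp
  then show ?thesis
    using assms(2) by simp
qed

text \<open>
  Each permutation in the Leibniz expansion contributes the product of one variable from each
  row of the submatrix, up to sign. Cancellation between permutations need not be excluded:
  the terms of a sum are among the terms of its summands.
\<close>

lemma term_of_minor:
  fixes m n :: nat
  assumes t: "t \<in> Poly_Mapping.keys (minor m n P Q :: 'k::field polynomial)"
    and P: "P \<subseteq> {..<m}" and Q: "Q \<subseteq> {..<n}" and card: "card P = card Q"
  obtains T where "finite T" "inj_on fst T" "t = squarefree_monomial T"
proof -
  let ?X = "generic_mat m n :: 'k polynomial mat"
  let ?r = "card P"
  have fin: "finite P" "finite Q"
    using P Q finite_subset by auto
  have PQ: "{i. i < m \<and> i \<in> P} = P" "{j. j < n \<and> j \<in> Q} = Q"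
    using P Q by auto
  have dims: "dim_row ?X = m" "dim_col ?X = n"
    by (simp_all add: generic_mat_def)
  have sub: "submatrix ?X P Q = mat ?r ?r (\<lambda>(i, j). Poly_Mapping.single (mono_var (pick P i) (pick Q j)) 1)"
  proof (rule eq_matI)
    fix i j
    assume "i < dim_row (mat ?r ?r (\<lambda>(i, j). Poly_Mapping.single (mono_var (pick P i) (pick Q j)) (1::'k)))"
      and "j < dim_col (mat ?r ?r (\<lambda>(i, j). Poly_Mapping.single (mono_var (pick P i) (pick Q j)) (1::'k)))"
    then have ij: "i < ?r" "j < ?r" by simp_all
    then have "pick P i < m" "pick Q j < n"
      using P Q pick_in_set_le[of i P] pick_in_set_le[of j Q] card by auto
    with ij show "submatrix ?X P Q $$ (i, j) =
        mat ?r ?r (\<lambda>(i, j). Poly_Mapping.single (mono_var (pick P i) (pick Q j)) 1) $$ (i, j)"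
      by (simp add: submatrix_def dims PQ card) (simp add: generic_mat_def)
  qed (simp_all add: dim_submatrix dims PQ card)
  let ?g = "\<lambda>p. \<Sum>i = 0..<?r. mono_var (pick P i) (pick Q (p i))"
  have "minor m n P Q = (\<Sum>p | p permutes {0..<?r}.
      of_int (sign p) * (\<Prod>i = 0..<?r. Poly_Mapping.single (mono_var (pick P i) (pick Q (p i))) (1::'k)))"
    unfolding minor_def sub
    by (subst det_def'[of _ ?r]) (auto intro!: sum.cong prod.cong dest: permutes_nat_less)
  also have "\<dots> = (\<Sum>p | p permutes {0..<?r}. of_int (sign p) * Poly_Mapping.single (?g p) 1)"
    by (simp add: prod_single)
  finally have expansion: "minor m n P Q = \<dots>" .
  have "t \<in> (\<Union>p\<in>{p. p permutes {0..<?r}}.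
      Poly_Mapping.keys (of_int (sign p) * Poly_Mapping.single (?g p) (1::'k)))"
    using t unfolding expansion by (rule subsetD[OF keys_sum])
  then obtain p where p: "p permutes {0..<?r}" 
    and tp: "t \<in> Poly_Mapping.keys (of_int (sign p) * Poly_Mapping.single (?g p) (1::'k))"
    by auto
  have "t = ?g p"
    using tp by (cases "sign p = 1") (auto simp: sign_def split: if_splits)
  let ?ps = "map (\<lambda>i. (pick P i, pick Q (p i))) [0..<?r]"
  have "sorted_wrt (<) (map fst ?ps)"
    by (auto simp: sorted_wrt_iff_nth_less intro: pick_mono_le)
  then have "distinct (map fst ?ps)"
    by (simp only: strict_sorted_iff)
  then have "inj_on fst (set ?ps)" "distinct ?ps"
    by (simp_all only: distinct_map)
  moreover have "t = squarefree_monomial (set ?ps)"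
    using \<open>t = ?g p\<close> sum_nth_eq_squarefree_monomial[OF \<open>distinct ?ps\<close>]
    by (simp add: mono_var_def lessThan_atLeast0)
  ultimately show thesis
    using that[of "set ?ps"] by blast
qed

section \<open>Chains of positions\<close>

text \<open>
  A chain is a list rather than a set, so that its column list can be compared with subsequences
  of the column sequence and its \<open>k\<close>-th element with the \<open>k\<close>-th factor of a leading term.
\<close>

definition chain :: "(nat \<Rightarrow> nat \<Rightarrow> bool) \<Rightarrow> (nat \<times> nat) list \<Rightarrow> bool" where
  "chain ord ps \<longleftrightarrow> sorted_wrt (<) (map fst ps) \<and> sorted_wrt ord (map snd ps)"

lemma chain_distinct:
  assumes "chain ord ps"
  shows "distinct ps" "distinct (map fst ps)"
  using assms by (auto simp: chain_def strict_sorted_iff distinct_map)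

lemma distinct_columns:
  assumes "chain ord ps" "irreflp ord"
  shows "distinct (map snd ps)"
proof -
  have "sorted_wrt (\<noteq>) (map snd ps)"
    using assms by (auto simp: chain_def irreflp_def elim!: sorted_wrt_mono_rel[rotated])
  then show ?thesis
    by (simp add: distinct_conv_nth sorted_wrt_iff_nth_less) (metis nat_neq_iff)
qed

lemma (in linorder) sorted_key_list_of_set_injective:
  assumes "finite S" "inj_on f S"
  shows "sorted_wrt (<) (map f (sorted_key_list_of_set f S))"
    and "set (sorted_key_list_of_set f S) = S"
proof -
  interpret folding_insort_key "(\<le>)" "(<)" S f
    by standard (rule assms)
  show "sorted_wrt (<) (map f (sorted_key_list_of_set f S))"
    and "set (sorted_key_list_of_set f S) = S"
    using assms(1) by simp_all
qed

lemma (in linorder) sorted_key_list_of_set_strict_sorted: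
  assumes "sorted_wrt (<) (map f xs)"
  shows "sorted_key_list_of_set f (set xs) = xs"
proof -
  have xs: "sorted (map f xs)" "distinct (map f xs)"
    using assms by (simp_all add: strict_sorted_iff)
  interpret folding_insort_key "(\<le>)" "(<)" "set xs" f
    by standard (use xs in \<open>simp add: distinct_map\<close>)
  show ?thesis
    using xs by (intro idem_if_sorted_distinct) (simp_all add: distinct_map)
qed

text \<open>
  A subsequence of columns is lifted to positions by selecting the same indices. Conversely, a
  chain in \<open>S\<close> is what remains of the row-sorted list of \<open>S\<close> when it is filtered for the members
  of the chain, since a set with distinct rows has only one row-sorted listing.
\<close>

lemma subseq_sorted_key_list_iff_chain:
  assumes "finite S" "inj_on fst S"
  shows "(\<exists>ys. subseq ys (map snd (sorted_key_list_of_set fst S)) \<and> sorted_wrt ord ys \<and> length ys = r)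
    \<longleftrightarrow> (\<exists>ps. chain ord ps \<and> set ps \<subseteq> S \<and> length ps = r)"
proof -
  let ?L = "sorted_key_list_of_set fst S"
  note L = sorted_key_list_of_set_injective[OF assms]
  show ?thesis
  proof safe
    fix ys assume ys: "subseq ys (map snd ?L)" "sorted_wrt ord ys" "r = length ys"
    then obtain N where N: "ys = map snd (nths ?L N)"
      by (auto simp: subseq_conv_nths nths_map)
    have "sorted_wrt (<) (map fst (nths ?L N))"
      using L(1) by (simp add: strict_sorted_iff sorted_nths flip: nths_map)
    then have "chain ord (nths ?L N)"
      using ys N by (simp add: chain_def)
    then show "\<exists>ps. chain ord ps \<and> set ps \<subseteq> S \<and> length ps = length ys"
      using set_nths_subset[of ?L N] L(2) N by auto
  next
    fix ps assume ps: "chain ord ps" "set ps \<subseteq> S" "r = length ps"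
    let ?F = "filter (\<lambda>x. x \<in> set ps) ?L"
    have "sorted_key_list_of_set fst (set ps) = ps"
      using ps(1) by (intro sorted_key_list_of_set_strict_sorted) (simp add: chain_def)
    moreover have "sorted_key_list_of_set fst (set ?F) = ?F"
      using L(1) by (intro sorted_key_list_of_set_strict_sorted)
        (simp add: sorted_wrt_map sorted_wrt_filter)
    moreover have "set ?F = set ps"
      using L ps by auto
    ultimately have "?F = ps"
      by simp
    then have "subseq ps ?L"
      by (metis subseq_filter_left)
    then have "subseq (map snd ps) (map snd ?L)"
      by (rule subseq_map)
    then show "\<exists>ys. subseq ys (map snd ?L) \<and> sorted_wrt ord ys \<and> length ys = length ps"
      using ps by (auto simp: chain_def)
  qed
qed

text \<open>
  Truncating a monotone subsequence keeps it monotone, so a longest one of length at least \<open>r\<close>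
  yields one of length exactly \<open>r\<close>, the size of the minors to be matched.
\<close>

lemma le_Max_subseq_length_iff:
  "r \<le> Max {length ys | ys. subseq ys zs \<and> sorted_wrt ord ys}
    \<longleftrightarrow> (\<exists>ys. subseq ys zs \<and> sorted_wrt ord ys \<and> length ys = r)"
proof -
  let ?N = "{length ys | ys. subseq ys zs \<and> sorted_wrt ord ys}"
  have "?N \<subseteq> {..length zs}"
    by (auto dest: list_emb_length)
  then have fin: "finite ?N"
    by (rule finite_subset) simp
  have "length [] \<in> ?N"
    by (intro CollectI exI[of _ "[]"]) simp
  then have ne: "?N \<noteq> {}"
    by blast
  show ?thesis
  proof
    assume "r \<le> Max ?N"
    then obtain ys where ys: "subseq ys zs" "sorted_wrt ord ys" "r \<le> length ys"
      using Max_in[OF fin ne] by auto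
    have "subseq (take r ys) zs"
      using ys(1) by (meson prefix_imp_subseq subseq_order.trans take_is_prefix)
    then show "\<exists>ys. subseq ys zs \<and> sorted_wrt ord ys \<and> length ys = r"
      using ys by (intro exI[of _ "take r ys"]) (simp add: sorted_wrt_take)
  next
    assume "\<exists>ys. subseq ys zs \<and> sorted_wrt ord ys \<and> length ys = r"
    then show "r \<le> Max ?N"
      using fin by (auto intro!: Max_ge)
  qed
qed

lemma length_ge_iff_chain:
  assumes "finite T" "inj_on fst T"
  shows "r \<le> Max {length ys | ys. subseq ys (col_seq (squarefree_monomial T) B) \<and> sorted_wrt ord ys}
    \<longleftrightarrow> (\<exists>ps. chain ord ps \<and> set ps \<subseteq> T \<inter> B \<and> length ps = r)"
  unfolding le_Max_subseq_length_iff col_seq_def keys_squarefree_monomial[OF assms(1)]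
  using assms by (intro subseq_sorted_key_list_iff_chain) (auto intro: inj_on_subset)

section \<open>Chains and submatrices\<close>

text \<open>
  The hypotheses \<open>ex\<close>, \<open>lead\<close> and \<open>block\<close> express that chains and pairs of equally large row and
  column sets determine each other: \<open>ex\<close> threads a chain through given sets, \<open>lead\<close> identifies the
  leading term of the submatrix spanned by a chain, and \<open>block\<close> keeps this submatrix inside \<open>B\<close>.
  Irreflexivity of \<open>ord\<close> makes the columns of a chain distinct, so that the submatrix is square.
\<close>

lemma minor_dvd_iff_chain:
  assumes T: "finite T" and B: "B \<subseteq> entries m n" and ord: "irreflp ord"
    and ex: "\<And>P Q. finite P \<Longrightarrow> finite Q \<Longrightarrow> card P = card Q \<Longrightarrow>
       \<exists>ps. chain ord ps \<and> fst ` set ps = P \<and> snd ` set ps = Q"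
    and lead: "\<And>ps. chain ord ps \<Longrightarrow>
       lead (fst ` set ps) (snd ` set ps) = squarefree_monomial (set ps)"
    and block: "\<And>ps. chain ord ps \<Longrightarrow> set ps \<subseteq> B \<Longrightarrow> fst ` set ps \<times> snd ` set ps \<subseteq> B"
  shows "(\<exists>(P, Q)\<in>minor_indices m n B r. mono_dvd (lead P Q) (squarefree_monomial T))
    \<longleftrightarrow> (\<exists>ps. chain ord ps \<and> set ps \<subseteq> T \<inter> B \<and> length ps = r)"
proof
  assume "\<exists>(P, Q)\<in>minor_indices m n B r. mono_dvd (lead P Q) (squarefree_monomial T)"
  then obtain P Q where PQ: "P \<subseteq> {..<m}" "Q \<subseteq> {..<n}" "card P = r" "card Q = r" "P \<times> Q \<subseteq> B"
    and dvd: "mono_dvd (lead P Q) (squarefree_monomial T)"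
    by (auto simp: minor_indices_def)
  obtain ps where ps: "chain ord ps" "fst ` set ps = P" "snd ` set ps = Q"
    using ex[of P Q] PQ finite_subset[of P] finite_subset[of Q] by auto
  \<comment> \<open>The leading term of the minor is the product over this chain, so the chain lies in \<open>T\<close>.\<close>
  have "set ps \<subseteq> T"
    using dvd lead[OF ps(1)] ps T by (simp add: squarefree_monomial_dvd_iff)
  moreover have "set ps \<subseteq> P \<times> Q"
    using ps by force
  moreover have "length ps = r"
    using distinct_card[OF chain_distinct(2)[OF ps(1)]] ps PQ by simp
  ultimately show "\<exists>ps. chain ord ps \<and> set ps \<subseteq> T \<inter> B \<and> length ps = r"
    using ps(1) PQ(5) by (intro exI[of _ ps]) auto
next
  assume "\<exists>ps. chain ord ps \<and> set ps \<subseteq> T \<inter> B \<and> length ps = r"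
  then obtain ps where ps: "chain ord ps" "set ps \<subseteq> T" "set ps \<subseteq> B" "length ps = r"
    by auto
  have "card (fst ` set ps) = r" "card (snd ` set ps) = r"
    using distinct_card[OF chain_distinct(2)[OF ps(1)]]
      distinct_card[OF distinct_columns[OF ps(1) ord]] ps(4) by simp_all
  moreover have "fst ` set ps \<subseteq> {..<m}" "snd ` set ps \<subseteq> {..<n}"
    using ps(3) B by (force simp: entries_def)+
  ultimately have "(fst ` set ps, snd ` set ps) \<in> minor_indices m n B r"
    using block[OF ps(1,3)] by (simp add: minor_indices_def)
  moreover have "mono_dvd (lead (fst ` set ps) (snd ` set ps)) (squarefree_monomial T)"
    using lead[OF ps(1)] ps(2) T by (simp add: squarefree_monomial_dvd_iff)
  ultimately show "\<exists>(P, Q)\<in>minor_indices m n B r. mono_dvd (lead P Q) (squarefree_monomial T)"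
    by (intro bexI[of _ "(fst ` set ps, snd ` set ps)"]) simp_all
qed

lemma ex_increasing_chain:
  assumes "finite P" "finite Q" "card P = card Q"
  shows "\<exists>ps. chain (<) ps \<and> fst ` set ps = P \<and> snd ` set ps = Q"
proof (intro exI conjI)
  let ?ps = "zip (sorted_list_of_set P) (sorted_list_of_set Q)"
  have maps: "map fst ?ps = sorted_list_of_set P" "map snd ?ps = sorted_list_of_set Q"
    using assms by simp_all
  show "chain (<) ?ps"
    unfolding chain_def maps by simp
  show "fst ` set ?ps = P" "snd ` set ?ps = Q"
    using assms maps by (metis list.set_map set_sorted_list_of_set)+
qed

lemma ex_decreasing_chain:
  assumes "finite P" "finite Q" "card P = card Q"
  shows "\<exists>ps. chain (>) ps \<and> fst ` set ps = P \<and> snd ` set ps = Q"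
proof (intro exI conjI)
  let ?ps = "zip (sorted_list_of_set P) (rev (sorted_list_of_set Q))"
  have maps: "map fst ?ps = sorted_list_of_set P" "map snd ?ps = rev (sorted_list_of_set Q)"
    using assms by simp_all
  show "chain (>) ?ps"
    unfolding chain_def maps by (simp add: sorted_wrt_rev)
  show "fst ` set ?ps = P" "snd ` set ?ps = Q"
    using assms maps by (metis list.set_map set_rev set_sorted_list_of_set)+
qed

lemma pick_set_strict_sorted:
  assumes "sorted_wrt (<) xs" "k < length xs"
  shows "pick (set xs) k = xs ! k"
proof -
  have "sorted_list_of_set (set xs) = xs"
    using assms by (simp add: strict_sorted_iff sorted_list_of_set.idem_if_sorted_distinct)
  then show ?thesis
    using assms by (simp add: pick_eq_nth_sorted_list_of_set distinct_card strict_sorted_iff)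
qed

lemma diagonal_product_chain:
  assumes "chain (<) ps"
  shows "diagonal_product (fst ` set ps) (snd ` set ps) = squarefree_monomial (set ps)"
proof -
  have rows: "sorted_wrt (<) (map fst ps)" and cols: "sorted_wrt (<) (map snd ps)"
    using assms by (simp_all add: chain_def)
  have "card (fst ` set ps) = length ps"
    using distinct_card[OF chain_distinct(2)[OF assms]] by simp
  moreover have "mono_var (pick (fst ` set ps) k) (pick (snd ` set ps) k) = Poly_Mapping.single (ps ! k) 1"
    if "k < length ps" for k
    using that pick_set_strict_sorted[OF rows, of k] pick_set_strict_sorted[OF cols, of k]
    by (simp add: mono_var_def)
  ultimately show ?thesis
    using sum_nth_eq_squarefree_monomial[OF chain_distinct(1)[OF assms]]
    by (simp add: diagonal_product_def)
qed

lemma antidiagonal_product_chain: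
  assumes "chain (>) ps"
  shows "antidiagonal_product (fst ` set ps) (snd ` set ps) = squarefree_monomial (set ps)"
proof -
  have rows: "sorted_wrt (<) (map fst ps)" and cols: "sorted_wrt (<) (rev (map snd ps))"
    using assms by (simp_all add: chain_def sorted_wrt_rev)
  have "card (fst ` set ps) = length ps" "card (snd ` set ps) = length ps"
    using distinct_card[OF chain_distinct(2)[OF assms]]
      distinct_card[OF distinct_columns[OF assms]] by (simp_all add: irreflp_def)
  moreover have "mono_var (pick (fst ` set ps) k) (pick (snd ` set ps) (length ps - 1 - k))
      = Poly_Mapping.single (ps ! k) 1"
    if "k < length ps" for k
  proof -
    \<comment> \<open>The columns decrease along the chain, so \<open>pick\<close> enumerates them from its end.\<close>
    have "pick (fst ` set ps) k = fst (ps ! k)"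
      using that pick_set_strict_sorted[OF rows, of k] by simp
    moreover have "pick (snd ` set ps) (length ps - 1 - k) = snd (ps ! k)"
      using that pick_set_strict_sorted[OF cols, of "length ps - 1 - k"]
      by (simp add: rev_nth)
    ultimately show ?thesis
      by (simp add: mono_var_def)
  qed
  ultimately show ?thesis
    using sum_nth_eq_squarefree_monomial[OF chain_distinct(1)[OF assms]]
    by (simp add: antidiagonal_product_def)
qed

text \<open>
  Take the row of one element of the chain and the column of another. Being comparable, the two
  elements are opposite corners of a rectangle that the block must contain; the entry asked for is
  one of the two remaining corners. Which element comes first is unknown, hence two cases.
\<close>

lemma diagonal_block_chain:
  assumes B: "diagonal_block B" and ps: "chain (<) ps" "set ps \<subseteq> B"
  shows "fst ` set ps \<times> snd ` set ps \<subseteq> B"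
proof (clarsimp simp: in_set_conv_nth)
  fix p q p' q' k l
  assume kl: "k < length ps" "ps ! k = (p, q)" "l < length ps" "ps ! l = (p', q')"
  have in_B: "(p, q) \<in> B" "(p', q') \<in> B"
    using kl ps(2) nth_mem by (metis subsetD)+
  have "k < l \<Longrightarrow> p < p' \<and> q < q'" "l < k \<Longrightarrow> p' < p \<and> q' < q"
    using kl ps(1) by (auto simp: chain_def sorted_wrt_iff_nth_less) fastforce+
  then consider "p \<le> p'" "q \<le> q'" | "p' \<le> p" "q' \<le> q"
    using kl by (metis Pair_inject less_imp_le nat_neq_iff order_refl)
  then show "(p, q') \<in> B"
    using B in_B unfolding diagonal_block_def by cases (force, force)
qed

text \<open>The same argument, with rectangles given by their lower left and upper right corners.\<close>

lemma antidiagonal_block_chain: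
  assumes B: "antidiagonal_block B" and ps: "chain (>) ps" "set ps \<subseteq> B"
  shows "fst ` set ps \<times> snd ` set ps \<subseteq> B"
proof (clarsimp simp: in_set_conv_nth)
  fix p q p' q' k l
  assume kl: "k < length ps" "ps ! k = (p, q)" "l < length ps" "ps ! l = (p', q')"
  have in_B: "(p, q) \<in> B" "(p', q') \<in> B"
    using kl ps(2) nth_mem by (metis subsetD)+
  have "k < l \<Longrightarrow> p < p' \<and> q' < q" "l < k \<Longrightarrow> p' < p \<and> q < q'"
    using kl ps(1) by (auto simp: chain_def sorted_wrt_iff_nth_less) fastforce+
  then consider "p \<le> p'" "q' \<le> q" | "p' \<le> p" "q \<le> q'"
    using kl by (metis Pair_inject less_imp_le nat_neq_iff order_refl)
  then show "(p, q') \<in> B"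
    using B in_B unfolding antidiagonal_block_def by cases (force, force)
qed

section \<open>Leading terms and lengths\<close>

text \<open>
  Being a term of a minor, \<open>t\<close> is squarefree with its variables in distinct rows, so both sides
  amount to a chain of length \<open>r\<close> in the positions of \<open>t\<close> inside \<open>B\<close>. The maximum is
  \<open>antidiagonal_length\<close> or \<open>diagonal_length\<close>, according to \<open>ord\<close>.
\<close>

lemma initial_term_dvd_iff_length:
  fixes f :: "'k::field polynomial"
  assumes f: "f \<in> minors_in m n A s" and t: "t \<in> Poly_Mapping.keys f"
    and B: "B \<subseteq> entries m n" and ord: "irreflp ord"
    and lt: "\<And>P Q. (P, Q) \<in> minor_indices m n B r \<Longrightarrow> lt R (minor m n P Q :: 'k polynomial) = lead P Q"
    and ex: "\<And>P Q. finite P \<Longrightarrow> finite Q \<Longrightarrow> card P = card Q \<Longrightarrow>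
       \<exists>ps. chain ord ps \<and> fst ` set ps = P \<and> snd ` set ps = Q"
    and lead: "\<And>ps. chain ord ps \<Longrightarrow>
       lead (fst ` set ps) (snd ` set ps) = squarefree_monomial (set ps)"
    and block: "\<And>ps. chain ord ps \<Longrightarrow> set ps \<subseteq> B \<Longrightarrow> fst ` set ps \<times> snd ` set ps \<subseteq> B"
  shows "(\<exists>g\<in>(minors_in m n B r :: 'k polynomial set). mono_dvd (lt R g) t)
    \<longleftrightarrow> Max {length ys | ys. subseq ys (col_seq t B) \<and> sorted_wrt ord ys} \<ge> r"
proof -
  obtain P Q where "P \<subseteq> {..<m}" "Q \<subseteq> {..<n}" "card P = card Q" "f = minor m n P Q"
    using f by (auto simp: minors_in_def minor_indices_def)
  with t obtain T where T: "finite T" "inj_on fst T" "t = squarefree_monomial T"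
    using term_of_minor by metis
  have "(\<exists>g\<in>(minors_in m n B r :: 'k polynomial set). mono_dvd (lt R g) t)
    \<longleftrightarrow> (\<exists>(P, Q)\<in>minor_indices m n B r. mono_dvd (lead P Q) t)"
    using lt by (force simp: minors_in_def)
  also have "\<dots> \<longleftrightarrow> (\<exists>ps. chain ord ps \<and> set ps \<subseteq> T \<inter> B \<and> length ps = r)"
    unfolding T(3) by (rule minor_dvd_iff_chain[OF T(1) B ord]) (fact ex lead block)+
  also have "\<dots> \<longleftrightarrow> Max {length ys | ys. subseq ys (col_seq t B) \<and> sorted_wrt ord ys} \<ge> r"
    unfolding T(3) by (rule length_ge_iff_chain[OF T(1,2), symmetric])
  finally show ?thesis .
qed


theorem theorem4p3:
  fixes m n :: nat
    and Bs :: "(nat \<times> nat) set list"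
    and rs :: "nat list"
    and I :: "'k::field polynomial set"
    and R :: "monomial rel"
  assumes "m \<le> n"
  shows
    "(antidiagonal_blockwise_ideal m n Bs rs I \<and> antidiagonal_term_order TYPE('k) m n R \<longrightarrow>
       (\<forall>i<length Bs. \<forall>f\<in>(minors_in m n (Bs ! i) (rs ! i) :: 'k polynomial set). \<forall>t\<in>Poly_Mapping.keys f.
          \<forall>j<length Bs. j \<noteq> i \<longrightarrow>
            ((\<exists>g\<in>(minors_in m n (Bs ! j) (rs ! j) :: 'k polynomial set). mono_dvd (lt R g) t)
             \<longleftrightarrow> antidiagonal_length t (Bs ! j) \<ge> rs ! j))) \<and>
     (diagonal_blockwise_ideal m n Bs rs I \<and> diagonal_term_order TYPE('k) m n R \<longrightarrow>
       (\<forall>i<length Bs. \<forall>f\<in>(minors_in m n (Bs ! i) (rs ! i) :: 'k polynomial set). \<forall>t\<in>Poly_Mapping.keys f.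
          \<forall>j<length Bs. j \<noteq> i \<longrightarrow>
            ((\<exists>g\<in>(minors_in m n (Bs ! j) (rs ! j) :: 'k polynomial set). mono_dvd (lt R g) t)
             \<longleftrightarrow> diagonal_length t (Bs ! j) \<ge> rs ! j)))"
proof (intro conjI impI allI ballI; elim conjE)
  fix i j f t
  assume I: "antidiagonal_blockwise_ideal m n Bs rs I" and R: "antidiagonal_term_order TYPE('k) m n R"
    and f: "f \<in> (minors_in m n (Bs ! i) (rs ! i) :: 'k polynomial set)" "t \<in> Poly_Mapping.keys f"
    and j: "j < length Bs"
  let ?B = "Bs ! j"
  have B: "?B \<subseteq> entries m n" "antidiagonal_block ?B" "0 < rs ! j"
    using I j by (auto simp: antidiagonal_blockwise_ideal_def block_data_def)
  show "(\<exists>g\<in>(minors_in m n ?B (rs ! j) :: 'k polynomial set). mono_dvd (lt R g) t)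
      \<longleftrightarrow> antidiagonal_length t ?B \<ge> rs ! j"
    unfolding antidiagonal_length_def
  proof (rule initial_term_dvd_iff_length[OF f B(1), where lead = antidiagonal_product])
    show "lt R (minor m n P Q :: 'k polynomial) = antidiagonal_product P Q"
      if "(P, Q) \<in> minor_indices m n ?B (rs ! j)" for P Q
    proof -
      have "(P, Q) \<in> minor_indices m n (entries m n) (rs ! j)"
        using that B(1) by (auto simp: minor_indices_def)
      then show ?thesis
        using R B(3) unfolding antidiagonal_term_order_def by blast
    qed
  qed (use ex_decreasing_chain antidiagonal_product_chain antidiagonal_block_chain[OF B(2)] in
      \<open>simp_all add: irreflp_def\<close>)
next
  fix i j f t
  assume I: "diagonal_blockwise_ideal m n Bs rs I" and R: "diagonal_term_order TYPE('k) m n R"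
    and f: "f \<in> (minors_in m n (Bs ! i) (rs ! i) :: 'k polynomial set)" "t \<in> Poly_Mapping.keys f"
    and j: "j < length Bs"
  let ?B = "Bs ! j"
  have B: "?B \<subseteq> entries m n" "diagonal_block ?B" "0 < rs ! j"
    using I j by (auto simp: diagonal_blockwise_ideal_def block_data_def)
  show "(\<exists>g\<in>(minors_in m n ?B (rs ! j) :: 'k polynomial set). mono_dvd (lt R g) t)
      \<longleftrightarrow> diagonal_length t ?B \<ge> rs ! j"
    unfolding diagonal_length_def
  proof (rule initial_term_dvd_iff_length[OF f B(1), where lead = diagonal_product])
    show "lt R (minor m n P Q :: 'k polynomial) = diagonal_product P Q"
      if "(P, Q) \<in> minor_indices m n ?B (rs ! j)" for P Q
    proof -
      have "(P, Q) \<in> minor_indices m n (entries m n) (rs ! j)"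
        using that B(1) by (auto simp: minor_indices_def)
      then show ?thesis
        using R B(3) unfolding diagonal_term_order_def by blast
    qed
  qed (use ex_increasing_chain diagonal_product_chain diagonal_block_chain[OF B(2)] in
      \<open>simp_all add: irreflp_def\<close>)
qed

end
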